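(* Let $X$ be a real Hilbert space. (1) Let $\alpha_1,\dots,\alpha_n\in X$, $b_1,\dots,b_n\in\mathbb{R}$, and let $$\mathcal{P}:=\{x\in X \mid \langle \alpha_i,x\rangle_X\le b_i,\ i=1,\dots,n\}.$$ Put $V_\alpha=\operatorname{Span}\{\alpha_1,\dots,\alpha_n\}$ and let $V_\alpha^\perp$ be its orthogonal complement in $X$. Then there exist finitely many elements $\{y_i\}_{i=1}^p\subset V_\alpha$ and finitely many elements $\{z_i\}_{i=1}^q\subset V_\alpha$ such that $$\mathcal{P}=V_\alpha^\perp+\operatorname{conv}(\{y_i\}_{i=1}^p)+\operatorname{cone}(\{z_i\}_{i=1}^q).$$ (2) Conversely, let $V\subset X$ be a finite-dimensional subspace, let $\{y_i\}_{i=1}^p,\{z_i\}_{i=1}^q\subset V$ be finite families, and suppose $$\mathcal{P}=V^\perp+\operatorname{conv}(\{y_i\}_{i=1}^p)+\operatorname{cone}(\{z_i\}_{i=1}^q).$$ Then there exist finitely many $\{\alpha_i\}_{i=1}^n\subset V$ and $\{b_i\}_{i=1}^n\subset\mathbb{R}$ such that $\mathcal{P}=\{x\in X\mid \langle\alpha_i,x\rangle_X\le b_i,\ i=1,\dots,n\}$.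
   Context: For a subset $U$ of a real vector space, $\operatorname{conv}(U)$ is the set of all finite convex combinations $\sum_{i=1}^m\lambda_i x_i$ with $x_i\in U$, $\lambda_i\ge 0$, $\sum_{i=1}^m\lambda_i=1$, and $\operatorname{cone}(U)$ is the set of all finite combinations $\sum_{i=1}^m\lambda_i x_i$ with $x_i\in U$, $\lambda_i\ge0$. Finite families may be empty, with the conventions $\operatorname{conv}(\emptyset)=\emptyset$ and $\operatorname{cone}(\emptyset)=\{0\}$. Sums of sets are Minkowski sums (empty if a summand is empty). *)

theory Defs
  imports "HOL-Analysis.Analysis"
begin

definition finite_dim_subspace :: "'a::real_vector set \<Rightarrow> bool"
  where "finite_dim_subspace V \<longleftrightarrow> subspace V \<and> (\<exists>B. finite B \<and> independent B \<and> span B = V)"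

text \<open>
  The set \<open>cone(U)\<close> of all finite nonnegative combinations of elements of \<open>U\<close> is
  \<open>convex_cone hull U\<close>, not \<open>cone hull U\<close>: the latter is only closed under nonnegative scaling,
  and \<open>cone hull {} = {}\<close>.  The next lemma confirms the explicit description (the empty
  combination \<open>m = 0\<close> gives 0); for \<open>convex hull\<close> see \<open>convex_hull_indexed\<close>.
\<close>

lemma convex_cone_hull_indexed:
  fixes U :: "'a::real_vector set"
  shows "convex_cone hull U =
    {v. \<exists>(m::nat) c x. (\<forall>i\<in>{1..m}. 0 \<le> c i \<and> x i \<in> U) \<and> v = (\<Sum>i=1..m. c i *\<^sub>R x i)}"
    (is "_ = ?R")
proof (rule hull_unique)
  show "U \<subseteq> ?R"
  proof
    fix u assume "u \<in> U"
    then show "u \<in> ?R"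
      by (auto intro!: exI[of _ "1::nat"] exI[of _ "\<lambda>_. 1::real"] exI[of _ "\<lambda>_. u"])
  qed
next
  have "0 \<in> ?R"
    by (auto intro!: exI[of _ "0::nat"])
  moreover have "a + b \<in> ?R" if ab: "a \<in> ?R" "b \<in> ?R" for a b
  proof -
    obtain m c x where 1: "\<forall>i\<in>{1..m::nat}. 0 \<le> c i \<and> x i \<in> U" "a = (\<Sum>i=1..m. c i *\<^sub>R x i)"
      using ab(1) by blast
    obtain k d y where 2: "\<forall>i\<in>{1..k::nat}. 0 \<le> d i \<and> y i \<in> U" "b = (\<Sum>i=1..k. d i *\<^sub>R y i)"
      using ab(2) by blast
    define e where "e i = (if i \<le> m then c i else d (i - m))" for i
    define z where "z i = (if i \<le> m then x i else y (i - m))" for i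
    have "(\<Sum>i=1..m+k. e i *\<^sub>R z i) = (\<Sum>i=1..m. e i *\<^sub>R z i) + (\<Sum>i=m+1..m+k. e i *\<^sub>R z i)"
      by (rule sum.ub_add_nat) simp
    also have "(\<Sum>i=1..m. e i *\<^sub>R z i) = a"
      unfolding 1 by (rule sum.cong) (auto simp: e_def z_def)
    also have "(\<Sum>i=m+1..m+k. e i *\<^sub>R z i) = (\<Sum>i=1..k. e (i + m) *\<^sub>R z (i + m))"
      using sum.shift_bounds_cl_nat_ivl[of "\<lambda>i. e i *\<^sub>R z i" 1 m k] by (simp add: add.commute)
    also have "\<dots> = b"
      unfolding 2 by (rule sum.cong) (auto simp: e_def z_def)
    finally have "a + b = (\<Sum>i=1..m+k. e i *\<^sub>R z i)" by simp
    moreover have "\<forall>i\<in>{1..m+k}. 0 \<le> e i \<and> z i \<in> U"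
    proof
      fix i assume i: "i \<in> {1..m+k}"
      show "0 \<le> e i \<and> z i \<in> U"
      proof (cases "i \<le> m")
        case True
        then show ?thesis using 1(1) i by (simp add: e_def z_def)
      next
        case False
        with i have "i - m \<in> {1..k}" by auto
        then show ?thesis using 2(1) False by (simp add: e_def z_def)
      qed
    qed
    ultimately show ?thesis by blast
  qed
  moreover have "t *\<^sub>R a \<in> ?R" if a: "a \<in> ?R" and t: "0 \<le> t" for a t
  proof -
    obtain m c x where 1: "\<forall>i\<in>{1..m::nat}. 0 \<le> c i \<and> x i \<in> U" "a = (\<Sum>i=1..m. c i *\<^sub>R x i)"
      using a by blast
    then have "t *\<^sub>R a = (\<Sum>i=1..m. (t * c i) *\<^sub>R x i)" "\<forall>i\<in>{1..m}. 0 \<le> t * c i \<and> x i \<in> U"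
      using t by (auto simp: scaleR_sum_right)
    then show ?thesis
      by (intro CollectI exI[of _ m] exI[of _ "\<lambda>i. t * c i"] exI[of _ x]) auto
  qed
  ultimately show "convex_cone ?R"
    unfolding convex_cone_iff by blast
next
  fix T :: "'a set"
  assume "U \<subseteq> T" and T: "convex_cone T"
  show "?R \<subseteq> T"
  proof
    fix v assume "v \<in> ?R"
    then obtain m c x where 1: "\<forall>i\<in>{1..m::nat}. 0 \<le> c i \<and> x i \<in> U" and v: "v = (\<Sum>i=1..m. c i *\<^sub>R x i)"
      by blast
    have "(\<Sum>i\<in>I. c i *\<^sub>R x i) \<in> T" if "finite I" "I \<subseteq> {1..m}" for I
      using that
    proof (induction I rule: finite_induct)
      case empty
      then show ?case using T convex_cone_contains_0 by auto
    next
      case (insert j I)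
      then show ?case
        using 1 T \<open>U \<subseteq> T\<close> by (auto simp: subset_iff intro!: convex_cone_add convex_cone_scaleR)
    qed
    then show "v \<in> T" unfolding v by simp
  qed
qed

end

theory Submission
  imports Defs
begin

text \<open>
  Both directions are homogenised: \<open>x \<in> conv Y + cone Z\<close> iff \<open>(x, 1)\<close> lies in the cone generated by
  \<open>Y \<times> {1} \<union> Z \<times> {0}\<close>. For cones, a half-space cuts a finitely generated cone in a finitely
  generated cone (double description: keep the generators inside and add the mixed combinations lying
  on the hyperplane), and adding a generator to a cone cut out by finitely many half-spaces leaves it
  cut out by finitely many half-spaces (Fourier-Motzkin elimination of the new coefficient). Starting
  from \<open>span B\<close>, resp. \<open>{0}\<close>, induction gives both implications without any closedness or
  separation argument. The factor \<open>V\<^sup>\<bottom>\<close> is split off by the orthogonal decomposition along the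
  finite-dimensional subspace \<open>V\<close>.
\<close>

section \<open>Cutting finitely generated cones by half-spaces\<close>

lemma subspace_imp_convex_cone: "subspace S \<Longrightarrow> convex_cone S"
  by (simp add: convex_cone_iff subspace_def)

lemma convex_cone_Int: "convex_cone S \<Longrightarrow> convex_cone T \<Longrightarrow> convex_cone (S \<inter> T)"
  by (simp add: convex_cone_iff)

lemma convex_cone_linear_vimage:
  assumes "linear f" "convex_cone S"
  shows "convex_cone {x. f x \<in> S}"
  using assms by (simp add: convex_cone_iff linear_0 linear_add linear_scale)

text \<open>Negation permutes the generators, so the hull is closed under negation and nonnegative
  scaling extends to all scalars. This makes the span of a finite set a finitely generated cone,
  from which the cutting can start.\<close>

lemma convex_cone_hull_symmetric_eq_span: "convex_cone hull (B \<union> uminus ` B) = span B"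
proof
  show "convex_cone hull (B \<union> uminus ` B) \<subseteq> span B"
    by (rule hull_minimal)
      (auto intro: span_base span_neg subspace_imp_convex_cone subspace_span)
  have "uminus ` (convex_cone hull (B \<union> uminus ` B)) = convex_cone hull (uminus ` (B \<union> uminus ` B))"
    by (rule convex_cone_hull_linear_image[symmetric])
      (rule module_hom_uminus[folded linear_def, unfolded linear_iff_module_hom])
  also have "uminus ` (B \<union> uminus ` B) = B \<union> uminus ` B"
    by (auto simp: image_Un image_image)
  finally have neg: "- x \<in> convex_cone hull (B \<union> uminus ` B)"
    if "x \<in> convex_cone hull (B \<union> uminus ` B)" for x
    using that by blast
  have "subspace (convex_cone hull (B \<union> uminus ` B))"
    unfolding subspace_def
  proof (intro conjI ballI allI)
    fix c x assume x: "x \<in> convex_cone hull (B \<union> uminus ` B)"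
    show "c *\<^sub>R x \<in> convex_cone hull (B \<union> uminus ` B)"
      using convex_cone_hull_mul[OF x, of c] convex_cone_hull_mul[OF neg[OF x], of "- c"]
      by (cases "0 \<le> c") auto
  qed (auto intro: convex_cone_hull_contains_0 convex_cone_hull_add)
  then show "span B \<subseteq> convex_cone hull (B \<union> uminus ` B)"
    by (intro span_minimal) (auto intro: hull_inc)
qed

text \<open>Mixing single generators is enough because
  \<open>(a \<bullet> p) *\<^sub>R n - (a \<bullet> n) *\<^sub>R p\<close> is linear in
  \<open>p\<close> and in \<open>n\<close> separately. A point of the cone can thus be split once
  into a part from \<open>M\<close> and a part from \<open>P\<close>, with no expansion into sums
  over generators.\<close>

lemma convex_cone_hull_Int_halfspace:
  fixes Z :: "'a::real_inner set"
  assumes Z: "finite Z"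
  obtains Z' where "finite Z'" "convex_cone hull Z' = convex_cone hull Z \<inter> {x. a \<bullet> x \<le> 0}"
proof -
  define P where "P = {z\<in>Z. a \<bullet> z > 0}"
  define M where "M = {z\<in>Z. a \<bullet> z \<le> 0}"
  define N where "N = M \<union> (\<lambda>(u, v). (a \<bullet> u) *\<^sub>R v - (a \<bullet> v) *\<^sub>R u) ` (P \<times> M)"
  have fin: "finite N"
    using Z by (simp add: N_def M_def P_def)
  have *: "(a \<bullet> u) *\<^sub>R v - (a \<bullet> v) *\<^sub>R u \<in> convex_cone hull Z \<inter> {x. a \<bullet> x \<le> 0}"
    if "u \<in> P" "v \<in> M" for u v
  proof -
    have "(a \<bullet> u) *\<^sub>R v + (- (a \<bullet> v)) *\<^sub>R u \<in> convex_cone hull Z"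
      using that by (intro convex_cone_hull_add convex_cone_hull_mul hull_inc) (auto simp: P_def M_def)
    then show ?thesis by (simp add: inner_diff_right)
  qed
  have "N \<subseteq> convex_cone hull Z \<inter> {x. a \<bullet> x \<le> 0}"
    unfolding N_def using * by (auto simp: M_def hull_inc)
  then have sub: "convex_cone hull N \<subseteq> convex_cone hull Z \<inter> {x. a \<bullet> x \<le> 0}"
    using convex_cone_Int[OF convex_cone_convex_cone_hull convex_cone_halfspace_le]
    by (rule hull_minimal)
  \<comment> \<open>For fixed \<open>u\<close>, the good \<open>n\<close> form the preimage of a
    convex cone under a linear map, hence a convex cone, and it contains \<open>M\<close>.
    \<open>mix2\<close> repeats the argument in the other variable.\<close>
  have mix1: "(a \<bullet> u) *\<^sub>R n - (a \<bullet> n) *\<^sub>R u \<in> convex_cone hull N"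
    if u: "u \<in> P" and n: "n \<in> convex_cone hull M" for u n
  proof -
    have "convex_cone hull M \<subseteq> {n. (a \<bullet> u) *\<^sub>R n - (a \<bullet> n) *\<^sub>R u \<in> convex_cone hull N}"
    proof (rule hull_minimal)
      show "M \<subseteq> {n. (a \<bullet> u) *\<^sub>R n - (a \<bullet> n) *\<^sub>R u \<in> convex_cone hull N}"
        using u by (auto intro!: hull_inc simp: N_def)
      show "convex_cone {n. (a \<bullet> u) *\<^sub>R n - (a \<bullet> n) *\<^sub>R u \<in> convex_cone hull N}"
        by (intro convex_cone_linear_vimage convex_cone_convex_cone_hull linearI)
          (simp_all add: algebra_simps inner_add_right)
    qed
    with n show ?thesis by blast
  qed
  have mix2: "(a \<bullet> p) *\<^sub>R n - (a \<bullet> n) *\<^sub>R p \<in> convex_cone hull N"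
    if p: "p \<in> convex_cone hull P" and n: "n \<in> convex_cone hull M" for p n
  proof -
    have "convex_cone hull P \<subseteq> {p. (a \<bullet> p) *\<^sub>R n - (a \<bullet> n) *\<^sub>R p \<in> convex_cone hull N}"
    proof (rule hull_minimal)
      show "P \<subseteq> {p. (a \<bullet> p) *\<^sub>R n - (a \<bullet> n) *\<^sub>R p \<in> convex_cone hull N}"
        using mix1 n by auto
      show "convex_cone {p. (a \<bullet> p) *\<^sub>R n - (a \<bullet> n) *\<^sub>R p \<in> convex_cone hull N}"
        by (intro convex_cone_linear_vimage convex_cone_convex_cone_hull linearI)
          (simp_all add: algebra_simps inner_add_right)
    qed
    with p show ?thesis by blast
  qed
  \<comment> \<open>An open half-space through the origin becomes a convex cone once 0 is added, so
    no nonzero \<open>p\<close> lies on the hyperplane. Below, this yields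
    \<open>a \<bullet> n < 0\<close> and permits division by it.\<close>
  have pos: "p = 0 \<or> a \<bullet> p > 0" if "p \<in> convex_cone hull P" for p
  proof -
    have "convex_cone hull P \<subseteq> {p. p = 0 \<or> a \<bullet> p > 0}"
      by (rule hull_minimal) (auto simp: P_def convex_cone_iff inner_add_right)
    with that show ?thesis by blast
  qed
  have "Z = M \<union> P"
    by (auto simp: M_def P_def)
  have "x \<in> convex_cone hull N" if x: "x \<in> convex_cone hull Z" and le: "a \<bullet> x \<le> 0" for x
  proof -
    obtain n p where n: "n \<in> convex_cone hull M" and p: "p \<in> convex_cone hull P" and x: "x = n + p"
      using x unfolding \<open>Z = M \<union> P\<close> convex_cone_hull_Un by blast
    have nN: "n \<in> convex_cone hull N"
      using n hull_mono[of M N convex_cone] by (auto simp: N_def)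
    txt \<open>If \<open>p \<noteq> 0\<close>, enough of \<open>n\<close> is paired with \<open>p\<close> to land on the hyperplane
      \<open>a \<bullet> x = 0\<close>; \<open>a \<bullet> x \<le> 0\<close> says that the rest of \<open>n\<close> is a nonnegative multiple.\<close>
    show ?thesis
    proof (cases "p = 0")
      case True
      with x nN show ?thesis by simp
    next
      case False
      with pos p have ap: "a \<bullet> p > 0" by blast
      then have an: "a \<bullet> n < 0" "a \<bullet> n + a \<bullet> p \<le> 0"
        using le by (auto simp: x inner_add_right)
      have "inverse (- (a \<bullet> n)) *\<^sub>R ((a \<bullet> p) *\<^sub>R n - (a \<bullet> n) *\<^sub>R p) + (1 + (a \<bullet> p) / (a \<bullet> n)) *\<^sub>R n
          \<in> convex_cone hull N"
        using an ap by (intro convex_cone_hull_add convex_cone_hull_mul mix2 p n nN)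
          (auto simp: field_simps)
      also have "inverse (- (a \<bullet> n)) *\<^sub>R ((a \<bullet> p) *\<^sub>R n - (a \<bullet> n) *\<^sub>R p) + (1 + (a \<bullet> p) / (a \<bullet> n)) *\<^sub>R n = x"
        using an by (simp add: x algebra_simps divide_inverse)
      finally show ?thesis .
    qed
  qed
  with sub have "convex_cone hull N = convex_cone hull Z \<inter> {x. a \<bullet> x \<le> 0}"
    by blast
  with fin show thesis by (rule that)
qed

lemma convex_cone_hull_Int_halfspaces:
  fixes Z :: "'a::real_inner set"
  assumes "finite A" "finite Z"
  shows "\<exists>Z'. finite Z' \<and> convex_cone hull Z' = convex_cone hull Z \<inter> {x. \<forall>a\<in>A. a \<bullet> x \<le> 0}"
  using assms(1)
proof induction
  case empty
  then show ?case using assms(2) by auto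
next
  case (insert a A)
  then obtain Z1 where "finite Z1"
    and Z1: "convex_cone hull Z1 = convex_cone hull Z \<inter> {x. \<forall>a\<in>A. a \<bullet> x \<le> 0}"
    by blast
  obtain Z2 where "finite Z2" "convex_cone hull Z2 = convex_cone hull Z1 \<inter> {x. a \<bullet> x \<le> 0}"
    using convex_cone_hull_Int_halfspace[OF \<open>finite Z1\<close>] .
  then show ?case using Z1 by (intro exI[of _ Z2]) auto
qed

section \<open>Half-space descriptions of finitely generated cones\<close>

lemma convex_cone_hull_insert_iff:
  "x \<in> convex_cone hull (insert z G) \<longleftrightarrow> (\<exists>t\<ge>0. x - t *\<^sub>R z \<in> convex_cone hull G)"
proof -
  have "x \<in> convex_cone hull (insert z G) \<longleftrightarrow>
      (\<exists>u\<in>convex_cone hull G. \<exists>v\<in>convex_cone hull {z}. x = u + v)"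
    using convex_cone_hull_Un[of G "{z}"] by auto
  also have "convex_cone hull {z} = {v. \<exists>t\<ge>0. v = t *\<^sub>R z}"
    by (auto simp: convex_cone_hull_convex_hull intro: exI[of _ 0])
  finally show ?thesis
    by (auto simp: algebra_simps intro: exI[of _ "_ *\<^sub>R z"])
       (metis add.commute diff_add_cancel)
qed

text \<open>The description is relative to \<open>span B\<close>, since in infinite dimension
  finitely many half-spaces through 0 cannot cut out \<open>{0}\<close>. For a new generator
  \<open>z\<close>, membership asks for a coefficient \<open>t \<ge> 0\<close> with
  \<open>a \<bullet> x \<le> t * (a \<bullet> z)\<close> for all \<open>a\<close> in
  \<open>A\<close>; it exists iff every lower bound on \<open>t\<close> is compatible with every
  upper bound.\<close>

lemma convex_cone_hull_eq_Int_halfspaces: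
  fixes G :: "'a::real_inner set"
  assumes "finite G" "finite B" "G \<subseteq> span B"
  shows "\<exists>A. finite A \<and> A \<subseteq> span B \<and> convex_cone hull G = {x \<in> span B. \<forall>a\<in>A. a \<bullet> x \<le> 0}"
  using assms(1,3)
proof (induction G)
  case empty
  \<comment> \<open>Opposite normals force \<open>x\<close> to be orthogonal to \<open>B\<close>,
    hence to \<open>span B\<close>, hence to itself.\<close>
  have "x = 0" if x: "x \<in> span B" and le: "\<forall>a\<in>B \<union> uminus ` B. a \<bullet> x \<le> 0" for x
  proof -
    have "orthogonal x b" if "b \<in> B" for b
    proof -
      have "b \<bullet> x \<le> 0" "- b \<bullet> x \<le> 0"
        using le that by blast+
      then show ?thesis by (simp add: orthogonal_def inner_commute)
    qed
    then have "orthogonal x x"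
      using orthogonal_to_span[OF x] by blast
    then show ?thesis by (simp add: orthogonal_self)
  qed
  then have "{0} = {x \<in> span B. \<forall>a\<in>B \<union> uminus ` B. a \<bullet> x \<le> 0}"
    by (auto simp: span_zero)
  then show ?case
    using assms(2) by (intro exI[of _ "B \<union> uminus ` B"]) (auto intro: span_base span_neg)
next
  case (insert z G)
  then obtain A where A: "finite A" "A \<subseteq> span B"
    and G: "convex_cone hull G = {x \<in> span B. \<forall>a\<in>A. a \<bullet> x \<le> 0}"
    by blast
  have z: "z \<in> span B"
    using insert by blast
  define P where "P = {a\<in>A. a \<bullet> z > 0}"
  define M where "M = {a\<in>A. a \<bullet> z \<le> 0}"
  \<comment> \<open>Each mixed normal is orthogonal to \<open>z\<close>, so \<open>t\<close> drops
    out of its inequality. The normals in \<open>M\<close> are kept unchanged because they are what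
    the constraint \<open>t \<ge> 0\<close> leaves of them.\<close>
  define N where "N = M \<union> (\<lambda>(a, c). (a \<bullet> z) *\<^sub>R c - (c \<bullet> z) *\<^sub>R a) ` (P \<times> M)"
  have fin: "finite P" "finite N"
    using A by (simp_all add: N_def M_def P_def)
  have "N \<subseteq> span B"
    using A by (auto simp: N_def M_def P_def intro!: span_diff span_mul)
  have "x \<in> convex_cone hull (insert z G) \<longleftrightarrow> x \<in> span B \<and> (\<forall>a\<in>N. a \<bullet> x \<le> 0)" for x
  proof -
    have "x \<in> convex_cone hull (insert z G) \<longleftrightarrow>
        (\<exists>t\<ge>0. x - t *\<^sub>R z \<in> span B \<and> (\<forall>a\<in>A. a \<bullet> x \<le> t * (a \<bullet> z)))"
      by (simp add: convex_cone_hull_insert_iff G inner_diff_right)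
    also have "\<dots> \<longleftrightarrow> x \<in> span B \<and> (\<exists>t\<ge>0. \<forall>a\<in>A. a \<bullet> x \<le> t * (a \<bullet> z))"
      using z by (metis diff_add_cancel span_add span_diff span_mul)
    also have "(\<exists>t\<ge>0. \<forall>a\<in>A. a \<bullet> x \<le> t * (a \<bullet> z)) \<longleftrightarrow> (\<forall>a\<in>N. a \<bullet> x \<le> 0)"
    proof
      assume "\<exists>t\<ge>0. \<forall>a\<in>A. a \<bullet> x \<le> t * (a \<bullet> z)"
      then obtain t where t: "t \<ge> 0" "\<And>a. a \<in> A \<Longrightarrow> a \<bullet> x \<le> t * (a \<bullet> z)"
        by blast
      have M: "c \<bullet> x \<le> 0" if "c \<in> M" for c
        using t(2)[of c] that t(1) mult_nonneg_nonpos[of t "c \<bullet> z"] by (auto simp: M_def)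
      \<comment> \<open>The constraint of \<open>c\<close> is scaled by
        \<open>a \<bullet> z > 0\<close> and that of \<open>a\<close> by
        \<open>c \<bullet> z \<le> 0\<close>, which reverses it; the two meet at the same multiple
        of \<open>t\<close>.\<close>
      have "(a \<bullet> z) * (c \<bullet> x) \<le> (c \<bullet> z) * (a \<bullet> x)" if "a \<in> P" "c \<in> M" for a c
      proof -
        have "(a \<bullet> z) * (c \<bullet> x) \<le> (a \<bullet> z) * (t * (c \<bullet> z))"
          using that t by (intro mult_left_mono) (auto simp: P_def M_def)
        also have "\<dots> = (c \<bullet> z) * (t * (a \<bullet> z))"
          by simp
        also have "\<dots> \<le> (c \<bullet> z) * (a \<bullet> x)"
          using that t by (intro mult_left_mono_neg) (auto simp: P_def M_def)
        finally show ?thesis .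
      qed
      with M show "\<forall>a\<in>N. a \<bullet> x \<le> 0"
        by (auto simp: N_def inner_diff_left)
    next
      assume N: "\<forall>a\<in>N. a \<bullet> x \<le> 0"
      \<comment> \<open>\<open>T\<close> collects the lower bounds on \<open>t\<close>, with 0
        standing for \<open>t \<ge> 0\<close>. Its maximum is attained, so for a normal in
        \<open>M\<close> only one bound has to be compared: 0 uses the normal itself, a quotient
        from \<open>c\<close> uses the mixed normal.\<close>
      define T where "T = insert 0 ((\<lambda>a. (a \<bullet> x) / (a \<bullet> z)) ` P)"
      define t where "t = Max T"
      have T: "finite T" "T \<noteq> {}"
        using fin by (simp_all add: T_def)
      have "t \<ge> 0"
        unfolding t_def using T by (intro Max_ge) (auto simp: T_def)
      moreover have "a \<bullet> x \<le> t * (a \<bullet> z)" if a: "a \<in> A" for a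
      proof (cases "a \<in> P")
        case True
        then have "(a \<bullet> x) / (a \<bullet> z) \<le> t"
          unfolding t_def using T by (intro Max_ge) (auto simp: T_def)
        then show ?thesis using True by (simp add: P_def field_simps)
      next
        case False
        with a have M: "a \<in> M" by (auto simp: M_def P_def)
        have "t \<in> T" unfolding t_def using T by (rule Max_in)
        then consider "t = 0" | c where "c \<in> P" "t = (c \<bullet> x) / (c \<bullet> z)"
          by (auto simp: T_def)
        then show ?thesis
        proof cases
          case 1
          then show ?thesis using N M by (auto simp: N_def)
        next
          case 2
          then have "(c \<bullet> z) *\<^sub>R a - (a \<bullet> z) *\<^sub>R c \<in> N"
            using M by (auto simp: N_def)
          then have "((c \<bullet> z) *\<^sub>R a - (a \<bullet> z) *\<^sub>R c) \<bullet> x \<le> 0"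
            using N by blast
          then have "a \<bullet> x \<le> (a \<bullet> z) * (c \<bullet> x) / (c \<bullet> z)"
            using 2 by (simp add: P_def field_simps inner_diff_left)
          then show ?thesis
            using 2 by (simp add: mult.commute)
        qed
      qed
      ultimately show "\<exists>t\<ge>0. \<forall>a\<in>A. a \<bullet> x \<le> t * (a \<bullet> z)" by blast
    qed
    finally show ?thesis .
  qed
  then show ?case
    using fin \<open>N \<subseteq> span B\<close> by (intro exI[of _ N]) blast
qed

section \<open>Orthogonal splitting along a finite-dimensional subspace\<close>

text \<open>A Gram-Schmidt step: the induction hypothesis is applied to the new vector
  \<open>a\<close>, giving its component \<open>w\<close> orthogonal to \<open>S\<close>, and to
  \<open>x\<close>, whose projection is then corrected along \<open>w\<close>.\<close>

lemma finite_span_orthogonal_decomposition: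
  fixes S :: "'a::real_inner set"
  assumes "finite S"
  shows "\<exists>y\<in>span S. \<forall>s\<in>S. orthogonal s (x - y)"
  using assms
proof (induction S arbitrary: x)
  case empty
  then show ?case by (auto simp: span_zero)
next
  case (insert a S)
  obtain a' where a': "a' \<in> span S" "\<forall>s\<in>S. orthogonal s (a - a')"
    using insert.IH by blast
  obtain y where y: "y \<in> span S" "\<forall>s\<in>S. orthogonal s (x - y)"
    using insert.IH by blast
  define w where "w = a - a'"
  \<comment> \<open>If \<open>a\<close> already lies in \<open>span S\<close>, then
    \<open>w = 0\<close> and the quotient is 0 by convention; the correction vanishes in any
    case.\<close>
  define k where "k = ((x - y) \<bullet> w) / (w \<bullet> w)"
  have sub: "span S \<subseteq> span (insert a S)"
    by (rule span_mono) auto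
  have "w \<in> span (insert a S)"
    unfolding w_def using a' sub by (auto intro: span_diff span_base)
  then have mem: "y + k *\<^sub>R w \<in> span (insert a S)"
    using y sub by (auto intro: span_add span_mul)
  have S: "orthogonal s (x - (y + k *\<^sub>R w))" if "s \<in> S" for s
  proof -
    have "s \<bullet> (x - y) = 0" "s \<bullet> w = 0"
      using that a' y unfolding w_def orthogonal_def by blast+
    then show ?thesis
      by (simp add: orthogonal_def inner_diff_right inner_add_right)
  qed
  then have "orthogonal (x - (y + k *\<^sub>R w)) a'"
    using a'(1) by (intro orthogonal_to_span[of a' S]) (auto simp: orthogonal_commute)
  moreover have "w \<bullet> (x - (y + k *\<^sub>R w)) = 0"
    by (cases "w = 0") (auto simp: k_def inner_diff_right inner_add_right inner_commute)
  moreover have "a = a' + w"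
    by (simp add: w_def)
  ultimately have "orthogonal a (x - (y + k *\<^sub>R w))"
    by (simp add: orthogonal_def inner_add_left inner_commute)
  with S mem show ?case by blast
qed

lemma orthogonal_comp_span_iff: "u \<in> (span S)\<^sup>\<bottom> \<longleftrightarrow> (\<forall>s\<in>S. orthogonal s u)"
proof -
  have "orthogonal v u" if "\<forall>s\<in>S. orthogonal s u" "v \<in> span S" for v
    using orthogonal_to_span[of v S u] that by (auto simp: orthogonal_commute)
  then show ?thesis
    by (auto simp: orthogonal_comp_def span_base)
qed

text \<open>Normals in \<open>span B\<close> see only the component of \<open>x\<close> in
  \<open>span B\<close>. The index type is left general so that the constraints may be a set of
  normal-bound pairs indexed by itself.\<close>

lemma halfspaces_eq_orthogonal_comp_plus:
  fixes \<alpha> :: "'i \<Rightarrow> 'a::real_inner"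
  assumes "finite B" and \<alpha>: "\<alpha> ` I \<subseteq> span B"
  shows "{x. \<forall>i\<in>I. \<alpha> i \<bullet> x \<le> b i} = (span B)\<^sup>\<bottom> + {x\<in>span B. \<forall>i\<in>I. \<alpha> i \<bullet> x \<le> b i}"
proof -
  have inv: "\<alpha> i \<bullet> (u + v) = \<alpha> i \<bullet> v" if "u \<in> (span B)\<^sup>\<bottom>" "i \<in> I" for u v i
    using that \<alpha> by (auto simp: orthogonal_comp_def orthogonal_def inner_add_right image_subset_iff)
  show ?thesis
  proof (intro equalityI subsetI)
    fix x assume x: "x \<in> {x. \<forall>i\<in>I. \<alpha> i \<bullet> x \<le> b i}"
    obtain y where y: "y \<in> span B" "\<forall>s\<in>B. orthogonal s (x - y)"
      using finite_span_orthogonal_decomposition[OF assms(1)] by blast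
    then have u: "x - y \<in> (span B)\<^sup>\<bottom>"
      by (simp add: orthogonal_comp_span_iff)
    have "\<alpha> i \<bullet> y \<le> b i" if "i \<in> I" for i
      using inv[OF u that, of y] x that by (auto dest: bspec)
    then have "(x - y) + y \<in> (span B)\<^sup>\<bottom> + {x\<in>span B. \<forall>i\<in>I. \<alpha> i \<bullet> x \<le> b i}"
      using u y by (intro set_plus_intro) auto
    then show "x \<in> (span B)\<^sup>\<bottom> + {x\<in>span B. \<forall>i\<in>I. \<alpha> i \<bullet> x \<le> b i}" by simp
  qed (auto simp: inv elim!: set_plus_elim)
qed

section \<open>Homogenisation by one extra coordinate\<close>

text \<open>The last coordinate records the total weight placed on \<open>Y\<close>. For empty
  \<open>Y\<close> it is always 0, so both sides fail, in agreement with the empty convex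
  hull.\<close>

lemma Pair_1_mem_convex_cone_hull_iff:
  fixes Y Z :: "'a::real_vector set"
  shows "(x, 1::real) \<in> convex_cone hull (Y \<times> {1} \<union> Z \<times> {0}) \<longleftrightarrow>
    x \<in> convex hull Y + convex_cone hull Z"
proof -
  have lin: "linear (\<lambda>z::'a. (z, 0::real))"
    by (auto intro!: linearI)
  have "Z \<times> {0::real} = (\<lambda>z. (z, 0)) ` Z" by auto
  then have Z: "convex_cone hull (Z \<times> {0::real}) = (\<lambda>z. (z, 0)) ` (convex_cone hull Z)"
    by (simp add: convex_cone_hull_linear_image[OF lin])
  have Y: "convex_cone hull (Y \<times> {1::real}) =
      insert 0 (\<Union>y\<in>convex hull Y. \<Union>c\<in>{0..}. {(c *\<^sub>R y, c)})"
    by (auto simp: convex_cone_hull_convex_hull convex_hull_Times)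
  \<comment> \<open>The \<open>Z\<close> part has height 0, so the \<open>Y\<close> part has height
    1: it is not 0, and its scale \<open>c\<close> is 1.\<close>
  have "(x, 1::real) \<in> convex_cone hull (Y \<times> {1} \<union> Z \<times> {0}) \<longleftrightarrow>
      (\<exists>y\<in>convex hull Y. \<exists>z\<in>convex_cone hull Z. x = y + z)"
    unfolding convex_cone_hull_Un unfolding Y Z by (force simp: zero_prod_def)
  also have "\<dots> \<longleftrightarrow> x \<in> convex hull Y + convex_cone hull Z"
    by (auto simp: set_plus_def)
  finally show ?thesis .
qed

text \<open>Rescaling generators by positive factors keeps the cone. This brings arbitrary
  generators of nonnegative height into the shape from which a convex hull and a recession cone can
  be read off.\<close>

lemma convex_cone_hull_normalise_last:
  fixes W :: "('a::real_vector \<times> real) set"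
  assumes W: "\<And>w. w \<in> W \<Longrightarrow> snd w \<ge> 0"
  shows "convex_cone hull W = convex_cone hull
    ((\<lambda>w. fst w /\<^sub>R snd w) ` {w\<in>W. snd w > 0} \<times> {1} \<union> fst ` {w\<in>W. snd w = 0} \<times> {0})"
    (is "_ = convex_cone hull ?R")
proof
  show "convex_cone hull W \<subseteq> convex_cone hull ?R"
  proof (rule hull_minimal[where S = convex_cone, OF subsetI convex_cone_convex_cone_hull])
    fix w assume w: "w \<in> W"
    show "w \<in> convex_cone hull ?R"
    proof (cases "snd w = 0")
      case True
      with w have "w \<in> ?R" by (cases w) force
      then show ?thesis by (rule hull_inc)
    next
      case False
      with W[OF w] have pos: "snd w > 0" by simp
      with w have "(fst w /\<^sub>R snd w, 1) \<in> ?R" by blast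
      then have "snd w *\<^sub>R (fst w /\<^sub>R snd w, 1) \<in> convex_cone hull ?R"
        using pos by (intro convex_cone_hull_mul hull_inc) auto
      then show ?thesis using pos by simp
    qed
  qed
  show "convex_cone hull ?R \<subseteq> convex_cone hull W"
  proof (rule hull_minimal[where S = convex_cone, OF subsetI convex_cone_convex_cone_hull])
    fix r assume "r \<in> ?R"
    then consider w where "w \<in> W" "snd w > 0" "r = (fst w /\<^sub>R snd w, 1)"
      | w where "w \<in> W" "snd w = 0" "r = (fst w, 0)"
      by blast
    then show "r \<in> convex_cone hull W"
    proof cases
      case 1
      then have "inverse (snd w) *\<^sub>R w \<in> convex_cone hull W"
        by (intro convex_cone_hull_mul hull_inc) auto
      moreover have "inverse (snd w) *\<^sub>R w = r"
        using 1 by (cases w) auto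
      ultimately show ?thesis by simp
    next
      case 2
      then have "r = w" by (cases w) auto
      with 2 show ?thesis by (simp add: hull_inc)
    qed
  qed
qed

text \<open>Supplies a spanning set of the lifted space, finite when \<open>B\<close> is, as
  required by the half-space description relative to a span.\<close>

lemma span_Times_UNIV_real:
  fixes B :: "'a::real_vector set"
  shows "span (B \<times> {0} \<union> {(0, 1::real)}) = span B \<times> UNIV"
proof
  have "subspace (span B \<times> (UNIV :: real set))"
    by (rule subspace_Times) auto
  then show "span (B \<times> {0} \<union> {(0, 1::real)}) \<subseteq> span B \<times> UNIV"
    by (intro span_minimal) (auto simp: span_base span_zero)
  have lin: "linear (\<lambda>z::'a. (z, 0::real))"
    by (auto intro!: linearI)
  show "span B \<times> UNIV \<subseteq> span (B \<times> {0} \<union> {(0, 1::real)})"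
  proof clarify
    fix x :: 'a and t :: real assume "x \<in> span B"
    then have "(x, 0) \<in> span ((\<lambda>z. (z, 0::real)) ` B)"
      by (simp add: linear_span_image[OF lin])
    then have "(x, 0) \<in> span (B \<times> {0} \<union> {(0, 1::real)})"
      by (rule rev_subsetD) (auto intro!: span_mono)
    then have "(x, 0) + t *\<^sub>R (0, 1) \<in> span (B \<times> {0} \<union> {(0, 1::real)})"
      by (intro span_add span_mul) (auto intro: span_base)
    then show "(x, t) \<in> span (B \<times> {0} \<union> {(0, 1::real)})" by simp
  qed
qed

lemma finite_imp_range_1:
  assumes "finite S"
  obtains n :: nat and f where "f ` {1..n} = S"
  using ex_bij_betw_nat_finite_1[OF assms] by (auto simp: bij_betw_def)

section \<open>The two implications for finite sets\<close>

theorem halfspaces_imp_finitely_generated: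
  fixes \<alpha> :: "'i \<Rightarrow> 'a::real_inner"
  assumes "finite I"
  obtains Y Z where "finite Y" "finite Z" "Y \<subseteq> span (\<alpha> ` I)" "Z \<subseteq> span (\<alpha> ` I)"
    "{x. \<forall>i\<in>I. \<alpha> i \<bullet> x \<le> b i} = (span (\<alpha> ` I))\<^sup>\<bottom> + convex hull Y + convex_cone hull Z"
proof -
  define B where "B = \<alpha> ` I"
  \<comment> \<open>The slice of this cone at height 1 is \<open>span B\<close>, written as
    \<open>{0}\<close> plus the cone generated by \<open>B\<close> and its negatives. At
    \<open>(x, 1)\<close> the normals in \<open>H\<close> give
    \<open>\<alpha> i \<bullet> x - b i \<le> 0\<close>.\<close>
  define G where "G = {0::'a} \<times> {1::real} \<union> (B \<union> uminus ` B) \<times> {0}"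
  define H where "H = (\<lambda>i. (\<alpha> i, - b i)) ` I"
  have fin: "finite B" "finite G" "finite H"
    using assms by (simp_all add: B_def G_def H_def)
  obtain W where "finite W"
    and W: "convex_cone hull W = convex_cone hull G \<inter> {w. \<forall>h\<in>H. h \<bullet> w \<le> 0}"
    using convex_cone_hull_Int_halfspaces[OF fin(3,2)] by blast
  \<comment> \<open>Used twice: nonnegative heights allow normalising \<open>W\<close>, and the
    first factor puts \<open>Y\<close> and \<open>Z\<close> into \<open>span B\<close>.\<close>
  have "convex_cone hull G \<subseteq> span B \<times> {0..}"
    by (rule hull_minimal)
      (auto simp: G_def span_zero span_base span_neg convex_cone_iff zero_prod_def
        intro: span_add span_mul)
  then have W_sub: "W \<subseteq> span B \<times> {0..}"
    using W hull_subset[of W convex_cone] by blast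
  define Y where "Y = (\<lambda>w. fst w /\<^sub>R snd w) ` {w\<in>W. snd w > 0}"
  define Z where "Z = fst ` {w\<in>W. snd w = 0}"
  have YZ: "finite Y" "finite Z" "Y \<subseteq> span B" "Z \<subseteq> span B"
    using \<open>finite W\<close> W_sub by (auto simp: Y_def Z_def intro!: span_mul)
  have "convex hull Y + convex_cone hull Z = {x \<in> span B. \<forall>i\<in>I. \<alpha> i \<bullet> x \<le> b i}"
  proof (rule set_eqI)
    fix x
    have G: "(x, 1) \<in> convex_cone hull G \<longleftrightarrow> x \<in> span B"
      unfolding G_def Pair_1_mem_convex_cone_hull_iff convex_cone_hull_symmetric_eq_span
      by (simp add: set_plus_def)
    have "x \<in> convex hull Y + convex_cone hull Z \<longleftrightarrow> (x, 1) \<in> convex_cone hull W"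
      unfolding Pair_1_mem_convex_cone_hull_iff[symmetric] Y_def Z_def
      by (subst convex_cone_hull_normalise_last[of W]) (use W_sub in auto)
    also have "\<dots> \<longleftrightarrow> x \<in> span B \<and> (\<forall>i\<in>I. \<alpha> i \<bullet> x \<le> b i)"
      by (simp add: W G H_def)
    finally show "x \<in> convex hull Y + convex_cone hull Z \<longleftrightarrow>
        x \<in> {x \<in> span B. \<forall>i\<in>I. \<alpha> i \<bullet> x \<le> b i}" by simp
  qed
  with halfspaces_eq_orthogonal_comp_plus[of B \<alpha> I b] fin(1)
  have "{x. \<forall>i\<in>I. \<alpha> i \<bullet> x \<le> b i} = (span B)\<^sup>\<bottom> + convex hull Y + convex_cone hull Z"
    by (simp add: B_def span_superset add.assoc)
  with YZ show thesis
    unfolding B_def by (rule that)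
qed

theorem finitely_generated_imp_halfspaces:
  fixes Y Z B :: "'a::real_inner set"
  assumes "finite B" "finite Y" "finite Z" "Y \<subseteq> span B" "Z \<subseteq> span B"
  obtains A :: "('a \<times> real) set" where "finite A" "fst ` A \<subseteq> span B"
    "(span B)\<^sup>\<bottom> + convex hull Y + convex_cone hull Z = {x. \<forall>h\<in>A. fst h \<bullet> x \<le> snd h}"
proof -
  define G where "G = Y \<times> {1::real} \<union> Z \<times> {0}"
  define B' where "B' = B \<times> {0} \<union> {(0::'a, 1::real)}"
  have "finite G" "finite B'" "G \<subseteq> span B'"
    using assms unfolding B'_def span_Times_UNIV_real by (auto simp: G_def)
  then obtain H where H: "finite H" "H \<subseteq> span B \<times> UNIV"
    "convex_cone hull G = {w \<in> span B \<times> UNIV. \<forall>h\<in>H. h \<bullet> w \<le> 0}"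
    using convex_cone_hull_eq_Int_halfspaces[of G B'] unfolding B'_def span_Times_UNIV_real by blast
  \<comment> \<open>At height 1 the normal \<open>(a, s)\<close> reads
    \<open>a \<bullet> x + s \<le> 0\<close>, hence the bound \<open>- s\<close>. Pairs keep each
    normal with its bound.\<close>
  define A where "A = (\<lambda>(a, s). (a, - s)) ` H"
  have A: "finite A" "fst ` A \<subseteq> span B"
    using H by (auto simp: A_def)
  have "convex hull Y + convex_cone hull Z = {x \<in> span B. \<forall>h\<in>A. fst h \<bullet> x \<le> snd h}"
  proof (rule set_eqI)
    fix x
    have "x \<in> convex hull Y + convex_cone hull Z \<longleftrightarrow> (x, 1) \<in> convex_cone hull G"
      by (simp add: G_def Pair_1_mem_convex_cone_hull_iff)
    also have "\<dots> \<longleftrightarrow> x \<in> {x \<in> span B. \<forall>h\<in>A. fst h \<bullet> x \<le> snd h}"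
      unfolding H(3) A_def by (force simp: split_beta)
    finally show "x \<in> convex hull Y + convex_cone hull Z \<longleftrightarrow>
        x \<in> {x \<in> span B. \<forall>h\<in>A. fst h \<bullet> x \<le> snd h}" .
  qed
  with halfspaces_eq_orthogonal_comp_plus[OF assms(1) A(2), of snd]
  have "(span B)\<^sup>\<bottom> + convex hull Y + convex_cone hull Z = {x. \<forall>h\<in>A. fst h \<bullet> x \<le> snd h}"
    by (simp add: add.assoc)
  with A show thesis by (rule that)
qed

theorem theorem2p3:
  shows
    "(\<forall>(n::nat) (\<alpha> :: nat \<Rightarrow> 'a::{real_inner, complete_space}) (b :: nat \<Rightarrow> real) P.
        P = {x. \<forall>i\<in>{1..n}. \<alpha> i \<bullet> x \<le> b i} \<longrightarrow>
        (\<exists>(p::nat) (y :: nat \<Rightarrow> 'a) (q::nat) (z :: nat \<Rightarrow> 'a).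
            y ` {1..p} \<subseteq> span (\<alpha> ` {1..n}) \<and> z ` {1..q} \<subseteq> span (\<alpha> ` {1..n}) \<and>
            P = (span (\<alpha> ` {1..n}))\<^sup>\<bottom> + convex hull (y ` {1..p}) + convex_cone hull (z ` {1..q})))
     \<and>
     (\<forall>(V :: 'a set) (p::nat) (y :: nat \<Rightarrow> 'a) (q::nat) (z :: nat \<Rightarrow> 'a) P.
        finite_dim_subspace V \<longrightarrow>
        y ` {1..p} \<subseteq> V \<longrightarrow> z ` {1..q} \<subseteq> V \<longrightarrow>
        P = V\<^sup>\<bottom> + convex hull (y ` {1..p}) + convex_cone hull (z ` {1..q}) \<longrightarrow>
        (\<exists>(n::nat) (\<alpha> :: nat \<Rightarrow> 'a) (b :: nat \<Rightarrow> real).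
            \<alpha> ` {1..n} \<subseteq> V \<and> P = {x. \<forall>i\<in>{1..n}. \<alpha> i \<bullet> x \<le> b i}))"
proof (intro conjI allI impI)
  fix n :: nat and \<alpha> :: "nat \<Rightarrow> 'a" and b :: "nat \<Rightarrow> real" and P
  assume P: "P = {x. \<forall>i\<in>{1..n}. \<alpha> i \<bullet> x \<le> b i}"
  obtain Y Z where YZ: "finite Y" "finite Z" "Y \<subseteq> span (\<alpha> ` {1..n})" "Z \<subseteq> span (\<alpha> ` {1..n})"
    "P = (span (\<alpha> ` {1..n}))\<^sup>\<bottom> + convex hull Y + convex_cone hull Z"
    using halfspaces_imp_finitely_generated[of "{1..n}" \<alpha> b] unfolding P by blast
  \<comment> \<open>An infeasible system forces \<open>Y\<close> to be empty and so
    \<open>p = 0\<close>, since the other two summands contain 0.\<close>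
  obtain p :: nat and y where "y ` {1..p} = Y"
    using YZ(1) by (rule finite_imp_range_1)
  moreover obtain q :: nat and z where "z ` {1..q} = Z"
    using YZ(2) by (rule finite_imp_range_1)
  ultimately show "\<exists>(p::nat) (y :: nat \<Rightarrow> 'a) (q::nat) (z :: nat \<Rightarrow> 'a).
      y ` {1..p} \<subseteq> span (\<alpha> ` {1..n}) \<and> z ` {1..q} \<subseteq> span (\<alpha> ` {1..n}) \<and>
      P = (span (\<alpha> ` {1..n}))\<^sup>\<bottom> + convex hull (y ` {1..p}) + convex_cone hull (z ` {1..q})"
    using YZ by metis
next
  fix V :: "'a set" and p :: nat and y :: "nat \<Rightarrow> 'a" and q :: nat and z :: "nat \<Rightarrow> 'a" and P
  assume V: "finite_dim_subspace V" and yz: "y ` {1..p} \<subseteq> V" "z ` {1..q} \<subseteq> V"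
    and P: "P = V\<^sup>\<bottom> + convex hull (y ` {1..p}) + convex_cone hull (z ` {1..q})"
  obtain B where B: "finite B" "V = span B"
    using V by (auto simp: finite_dim_subspace_def)
  obtain A where A: "finite A" "fst ` A \<subseteq> V" "P = {x. \<forall>h\<in>A. fst h \<bullet> x \<le> snd h}"
    using finitely_generated_imp_halfspaces[OF B(1) finite_imageI finite_imageI, of "{1..p}" "{1..q}" y z] yz
    unfolding P B(2) by blast
  obtain n :: nat and h where h: "h ` {1..n} = A"
    using A(1) by (rule finite_imp_range_1)
  show "\<exists>(n::nat) (\<alpha> :: nat \<Rightarrow> 'a) (b :: nat \<Rightarrow> real).
      \<alpha> ` {1..n} \<subseteq> V \<and> P = {x. \<forall>i\<in>{1..n}. \<alpha> i \<bullet> x \<le> b i}"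
    using A(2) unfolding A(3) h[symmetric]
    by (intro exI[of _ n] exI[of _ "\<lambda>i. fst (h i)"] exI[of _ "\<lambda>i. snd (h i)"]) auto
qed

end
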